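(* Let $(X,d,\mu)$ be a space of homogeneous type with dyadic point sets $\mathscr{Y}^k$ as in the context, and let $\gamma>0$. For all $\nu,a>0$ there is a constant $C$ (independent of $x$ and $r$) such that for all $x\in X$ and $r>0$, $$\sum_{k\in\mathbb{Z}:\,\delta^k\ge r}V(x,\delta^k)^{-\nu}\exp\Big(-\gamma\big(\delta^{-k}d(x,\mathscr{Y}^k)\big)^a\Big)\le C\,V(x,r)^{-\nu}.$$
   Context: Space of homogeneous type: $d:X\times X\to[0,\infty)$ is symmetric, $d(x,y)=0$ iff $x=y$, $d(x,y)\le A_0(d(x,z)+d(z,y))$ with $A_0\ge1$; $\mu$ is a nontrivial Borel measure, balls $B(x,r)=\{y:d(x,y)<r\}$ are Borel sets, and $0<\mu(B(x,2r))\le C_\mu\mu(B(x,r))<\infty$ for all $x\in X$, $r>0$. Notation: $V(x,r):=\mu(B(x,r))$; $d(x,E)=\inf_{y\in E}d(x,y)$, with $d(x,\varnothing)=\infty$ (so the exponential factor is $0$ when $\mathscr{Y}^k=\varnothing$). Dyadic points: fix $\delta\in(0,1)$ with $\delta\le\frac1{1000}A_0^{-10}$. $\mathscr{X}^0$ is a maximal $1$-separated set in $X$ ($r$-separated: distinct points at distance $\ge r$); inductively for $k\ge1$, $\mathscr{X}^k\supseteq\mathscr{X}^{k-1}$ is a maximal $\delta^k$-separated set in $X$ and $\mathscr{X}^{-k}\subseteq\mathscr{X}^{-(k-1)}$ is a maximal $\delta^{-k}$-separated subset of $\mathscr{X}^{-(k-1)}$. Set $\mathscr{Y}^k:=\mathscr{X}^{k+1}\setminus\mathscr{X}^k$,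 $k\in\mathbb{Z}$. *)

theory Defs
  imports "HOL-Analysis.Analysis"
begin

definition qball :: "'a set \<Rightarrow> ('a \<Rightarrow> 'a \<Rightarrow> real) \<Rightarrow> 'a \<Rightarrow> real \<Rightarrow> 'a set" where
  "qball X d x r = {y \<in> X. d x y < r}"

text \<open>The topology induced by a quasi-metric. Quasi-metric balls need not be open in it,
  nor even Borel, whence the separate measurability assumption on balls below.\<close>

definition qopen :: "'a set \<Rightarrow> ('a \<Rightarrow> 'a \<Rightarrow> real) \<Rightarrow> 'a set \<Rightarrow> bool" where
  "qopen X d U \<longleftrightarrow> U \<subseteq> X \<and> (\<forall>x\<in>U. \<exists>r>0. qball X d x r \<subseteq> U)"

locale quasi_metric =
  fixes X :: "'a set" and d :: "'a \<Rightarrow> 'a \<Rightarrow> real" and A0 :: real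
  assumes A0_ge_1: "1 \<le> A0"
    and nonneg: "\<lbrakk>x \<in> X; y \<in> X\<rbrakk> \<Longrightarrow> 0 \<le> d x y"
    and sym: "\<lbrakk>x \<in> X; y \<in> X\<rbrakk> \<Longrightarrow> d x y = d y x"
    and zero_iff: "\<lbrakk>x \<in> X; y \<in> X\<rbrakk> \<Longrightarrow> d x y = 0 \<longleftrightarrow> x = y"
    and quasi_triangle: "\<lbrakk>x \<in> X; y \<in> X; z \<in> X\<rbrakk> \<Longrightarrow> d x y \<le> A0 * (d x z + d z y)"

locale homogeneous_type = quasi_metric X d A0
  for X :: "'a set" and d :: "'a \<Rightarrow> 'a \<Rightarrow> real" and A0 :: real +
  fixes M :: "'a measure" and C\<mu> :: real
  assumes space_eq: "space M = X"
    and borel_measure: "sets M = sigma_sets X {U. qopen X d U}"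
    and nontrivial: "emeasure M X \<noteq> 0"
    and ball_borel: "x \<in> X \<Longrightarrow> qball X d x r \<in> sets M"
    and ball_pos: "\<lbrakk>x \<in> X; 0 < r\<rbrakk> \<Longrightarrow> 0 < emeasure M (qball X d x (2 * r))"
    and doubling: "\<lbrakk>x \<in> X; 0 < r\<rbrakk> \<Longrightarrow>
      emeasure M (qball X d x (2 * r)) \<le> ennreal C\<mu> * emeasure M (qball X d x r)"
    and ball_finite: "\<lbrakk>x \<in> X; 0 < r\<rbrakk> \<Longrightarrow> ennreal C\<mu> * emeasure M (qball X d x r) < \<infinity>"

text \<open>Real-valued, since balls have finite measure in a space of homogeneous type.\<close>

definition Vol :: "'a set \<Rightarrow> ('a \<Rightarrow> 'a \<Rightarrow> real) \<Rightarrow> 'a measure \<Rightarrow> 'a \<Rightarrow> real \<Rightarrow> real" where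
  "Vol X d M x r = measure M (qball X d x r)"

text \<open>Taking the infimum in \<^typ>\<open>ennreal\<close> gives distance \<open>\<infinity>\<close> to the empty set.\<close>

definition set_dist :: "('a \<Rightarrow> 'a \<Rightarrow> real) \<Rightarrow> 'a \<Rightarrow> 'a set \<Rightarrow> ennreal" where
  "set_dist d x E = (INF y\<in>E. ennreal (d x y))"

definition separated :: "('a \<Rightarrow> 'a \<Rightarrow> real) \<Rightarrow> real \<Rightarrow> 'a set \<Rightarrow> bool" where
  "separated d r S \<longleftrightarrow> (\<forall>x\<in>S. \<forall>y\<in>S. x \<noteq> y \<longrightarrow> r \<le> d x y)"

definition maximal_separated ::
  "('a \<Rightarrow> 'a \<Rightarrow> real) \<Rightarrow> real \<Rightarrow> 'a set \<Rightarrow> 'a set \<Rightarrow> bool" where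
  "maximal_separated d r E S \<longleftrightarrow> S \<subseteq> E \<and> separated d r S \<and>
     (\<forall>T. S \<subseteq> T \<longrightarrow> T \<subseteq> E \<longrightarrow> separated d r T \<longrightarrow> T = S)"

locale dyadic_points = quasi_metric X d A0
  for X :: "'a set" and d :: "'a \<Rightarrow> 'a \<Rightarrow> real" and A0 :: real +
  fixes \<delta> :: real and P :: "int \<Rightarrow> 'a set"
  assumes \<delta>_pos: "0 < \<delta>" and \<delta>_less_1: "\<delta> < 1"
    and \<delta>_small: "\<delta> \<le> 1 / 1000 * A0 powi (-10)"
    and level_0: "maximal_separated d 1 X (P 0)"
    and pos_nested: "1 \<le> k \<Longrightarrow> P (k - 1) \<subseteq> P k"
    and pos_maximal: "1 \<le> k \<Longrightarrow> maximal_separated d (\<delta> powi k) X (P k)"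
    and neg_maximal:
      "1 \<le> k \<Longrightarrow> maximal_separated d (\<delta> powi (-k)) (P (- (k - 1))) (P (-k))"

definition new_points :: "(int \<Rightarrow> 'a set) \<Rightarrow> int \<Rightarrow> 'a set" where
  "new_points P k = P (k + 1) - P k"

text \<open>The value of \<open>exp (- \<gamma> t\<^sup>a)\<close> for \<open>\<gamma>, a > 0\<close> and \<open>t \<in> [0, \<infinity>]\<close>, with \<open>exp (- \<infinity>) = 0\<close>.\<close>

definition exp_decay :: "real \<Rightarrow> real \<Rightarrow> ennreal \<Rightarrow> real" where
  "exp_decay \<gamma> a t = (if t = \<infinity> then 0 else exp (- \<gamma> * enn2real t powr a))"

end

theory Submission
  imports Defs
begin

text \<open>
  Write \<open>V k = V(x, \<delta>\<^sup>k)\<close> and \<open>W k = (V k) powr (-\<nu>)\<close>. If \<open>d(x, Y\<^sup>k) < \<delta>\<^bsup>k-n\<^esup>\<close>, then a point of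
  \<open>P (k + 1)\<close> lies within about \<open>\<delta>\<^bsup>k-n\<^esup>\<close> of \<open>x\<close> but at least about \<open>\<delta>\<^bsup>k+1\<^esup>\<close> away from it. A small
  ball around that point misses \<open>B(x, \<delta>\<^bsup>k+2\<^esup>)\<close> and, by doubling, carries a proportion at least
  \<open>\<Lambda>\<^bsup>-(n+4)\<^esup>\<close> of \<open>V (k-n-1)\<close>, so that \<open>W k \<le> C \<Lambda>\<^bsup>n+4\<^esup> (W (k+2) - W (k-n-1))\<close>. The exponential
  factor beats \<open>\<Lambda>\<^sup>n\<close>, and for fixed \<open>n\<close> the differences telescope in \<open>k\<close>.
\<close>

section \<open>Telescoping sums of a monotone function on the integers\<close>

text \<open>A shift by \<open>m\<close> splits into \<open>m\<close> unit shifts. Each of them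
  telescopes to at most one value of \<open>f\<close>, and monotonicity bounds that value by
  \<open>f (K + int m)\<close>.\<close>

lemma sum_shift_difference_le:
  fixes f :: "int \<Rightarrow> real"
  assumes "mono f" and nonneg: "\<And>k. 0 \<le> f k" and "finite F" and "F \<subseteq> {..K}"
  shows "(\<Sum>k\<in>F. f (k + int m) - f k) \<le> real m * f (K + int m)"
proof (induction m)
  case 0
  then show ?case by simp
next
  case (Suc m)
  define g where "g k = f (k + int m)" for k
  have mono_g: "g k \<le> g l" if "k \<le> l" for k l
    unfolding g_def using that by (intro monoD[OF \<open>mono f\<close>]) simp
  have "\<exists>L\<le>K. F \<subseteq> {L..K}"
  proof (cases "F = {}")
    case False
    then have "F \<subseteq> {Min F..K}" using \<open>finite F\<close> \<open>F \<subseteq> {..K}\<close> by auto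
    with False show ?thesis by (intro exI[of _ "Min F"]) fastforce
  qed auto
  then obtain L where "L \<le> K" "F \<subseteq> {L..K}" by blast
  \<comment> \<open>Unit differences are nonnegative, so the gaps of \<open>F\<close> may be filled;
    over the full interval the sum telescopes.\<close>
  have "(\<Sum>k\<in>F. g (k + 1) - g k) \<le> (\<Sum>k\<in>{L..K}. g (k + 1) - g k)"
    using \<open>F \<subseteq> {L..K}\<close> mono_g by (intro sum_mono2) auto
  also have "\<dots> = g (K + 1) - g L"
    using \<open>L \<le> K\<close>
  proof (induction K rule: int_ge_induct)
    case (step i)
    have "{L..i + 1} = insert (i + 1) {L..i}" using step.hyps by auto
    then show ?case using step.IH by simp
  qed simp
  also have "\<dots> \<le> g (K + 1)" using nonneg[of "L + int m"] by (simp add: g_def)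
  finally have step: "(\<Sum>k\<in>F. g (k + 1) - g k) \<le> f (K + int (Suc m))"
    by (simp add: g_def algebra_simps)
  have "(\<Sum>k\<in>F. f (k + int (Suc m)) - f k)
      = (\<Sum>k\<in>F. g (k + 1) - g k) + (\<Sum>k\<in>F. f (k + int m) - f k)"
    unfolding g_def sum.distrib[symmetric] by (simp add: algebra_simps)
  also have "\<dots> \<le> f (K + int (Suc m)) + real m * f (K + int m)"
    using step Suc.IH by linarith
  also have "real m * f (K + int m) \<le> real m * f (K + int (Suc m))"
    by (intro mult_left_mono monoD[OF \<open>mono f\<close>]) auto
  finally show ?case by (simp add: algebra_simps)
qed

text \<open>The shift varies with \<open>k\<close>, which blocks direct telescoping. Each summand is
  therefore treated as one term of a nonnegative sum over all \<open>j \<le> N\<close>; after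
  exchanging the sums the shift is fixed and the previous lemma applies.\<close>

lemma sum_weighted_shift_difference_le:
  fixes f :: "int \<Rightarrow> real" and n :: "int \<Rightarrow> nat"
  assumes "mono f" and nonneg: "\<And>k. 0 \<le> f k" and "finite F" and "F \<subseteq> {..K}"
  shows "(\<Sum>k\<in>F. (1 / 4) ^ n k * (f (k + 2) - f (k - int (n k) - 1))) \<le> 6 * f (K + 2)"
proof -
  have mono_f: "f k \<le> f l" if "k \<le> l" for k l using \<open>mono f\<close> that by (rule monoD)
  obtain N where N: "n ` F \<subseteq> {..N}"
    using \<open>finite F\<close> finite_nat_iff_bounded_le[of "n ` F"] by blast
  have "(\<Sum>k\<in>F. (1 / 4) ^ n k * (f (k + 2) - f (k - int (n k) - 1)))
      \<le> (\<Sum>k\<in>F. \<Sum>j\<le>N. (1 / 4) ^ j * (f (k + 2) - f (k - int j - 1)))"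
    using N by (intro sum_mono member_le_sum) (auto intro!: mult_nonneg_nonneg mono_f)
  also have "\<dots> = (\<Sum>j\<le>N. (1 / 4) ^ j * (\<Sum>k\<in>F. f (k + 2) - f (k - int j - 1)))"
    by (subst sum.swap) (simp add: sum_distrib_left)
  also have "\<dots> \<le> (\<Sum>j\<le>N. 3 * (1 / 2) ^ j * f (K + 2))"
  proof (intro sum_mono)
    fix j
    \<comment> \<open>From the base point \<open>k - int j - 1\<close> a shift by
      \<open>j + 3\<close> arrives at \<open>k + 2\<close>, so the bound sits at
      \<open>K + 2\<close> for every \<open>j\<close>.\<close>
    have "mono (\<lambda>k. f (k - int j - 1))" by (intro monoI mono_f) auto
    from sum_shift_difference_le[OF this nonneg \<open>finite F\<close> \<open>F \<subseteq> {..K}\<close>, of "j + 3"]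
    have "(\<Sum>k\<in>F. f (k + 2) - f (k - int j - 1)) \<le> real (j + 3) * f (K + 2)"
      by (simp add: algebra_simps)
    \<comment> \<open>Trading the linear factor for \<open>3 * 2 ^ j\<close> leaves ratio 1/2
      against the weight \<open>(1 / 4) ^ j\<close>; the geometric sum is at most 2, which gives the
      constant 6.\<close>
    also have "real (j + 3) \<le> 3 * 2 ^ j"
      by (induction j) auto
    finally have "(\<Sum>k\<in>F. f (k + 2) - f (k - int j - 1)) \<le> 3 * 2 ^ j * f (K + 2)"
      using nonneg[of "K + 2"] by (simp add: mult_right_mono)
    then have "(1 / 4) ^ j * (\<Sum>k\<in>F. f (k + 2) - f (k - int j - 1))
        \<le> (1 / 4) ^ j * (3 * 2 ^ j * f (K + 2))"
      by (rule mult_left_mono) simp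
    also have "\<dots> = 3 * ((1 / 4) ^ j * 2 ^ j) * f (K + 2)" by simp
    also have "(1 / 4) ^ j * 2 ^ j = (1 / 2 :: real) ^ j"
      by (simp flip: power_mult_distrib)
    finally show "(1 / 4) ^ j * (\<Sum>k\<in>F. f (k + 2) - f (k - int j - 1))
        \<le> 3 * (1 / 2) ^ j * f (K + 2)" .
  qed
  also have "\<dots> = 3 * f (K + 2) * (\<Sum>j\<le>N. (1 / 2) ^ j)"
    by (simp add: sum_distrib_left mult_ac)
  also have "\<dots> \<le> 3 * f (K + 2) * 2"
  proof (intro mult_left_mono)
    have "(\<Sum>j\<le>N. (1 / 2) ^ j) = 2 - (1 / 2 :: real) ^ N"
      by (induction N) (auto simp: field_simps)
    then show "(\<Sum>j\<le>N. (1 / 2 :: real) ^ j) \<le> 2" by simp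
  qed (simp add: nonneg)
  finally show ?thesis by simp
qed

section \<open>Elementary inequalities for exponentials and negative powers\<close>

lemma exp_minus_le_fact_div_power:
  fixes t :: real
  assumes "0 < t"
  shows "exp (- t) \<le> fact m / t ^ m"
proof -
  have "(\<lambda>n. t ^ n /\<^sub>R fact n) sums exp t" by (rule exp_converges)
  then have "t ^ m /\<^sub>R fact m \<le> exp t"
    using assms sum_le_suminf[of "\<lambda>n. t ^ n /\<^sub>R fact n" "{m}"]
    by (auto simp: sums_iff)
  then show ?thesis using assms by (simp add: exp_minus field_simps)
qed

text \<open>For the least admissible \<open>n\<close>, \<open>t\<close> is at least
  \<open>(1 / \<delta>) ^ (n - 1)\<close> when \<open>n > 0\<close>. Then \<open>t\<close> to the
  power \<open>a\<close> grows geometrically in \<open>n\<close>, and the exponential decays faster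
  than any prescribed ratio \<open>q\<close>.\<close>

lemma exp_decay_geometric:
  assumes "0 < \<delta>" "\<delta> < 1" "0 < \<gamma>" "0 < a" "0 < q"
  obtains C where "0 < C"
    and "\<And>t. t \<noteq> \<infinity> \<Longrightarrow> \<exists>n. t < ennreal ((1 / \<delta>) ^ n) \<and> exp_decay \<gamma> a t \<le> C * q ^ n"
proof -
  define p where "p = \<delta> powr a"
  have p: "0 < p" "p < 1" using assms powr_less_mono2[of a \<delta> 1] by (simp_all add: p_def)
  \<comment> \<open>Inverse power decay of order \<open>m\<close> in \<open>(1 / p) ^ l\<close>
    already beats \<open>q ^ l\<close>.\<close>
  obtain m where m: "p ^ m < q" using real_arch_pow_inv[OF \<open>0 < q\<close> \<open>p < 1\<close>] by blast
  \<comment> \<open>The entry 1 serves \<open>n = 0\<close>, where the exponential is at most 1. The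
    other entry carries \<open>1 / q\<close> because for \<open>n = Suc l\<close> the estimate is
    obtained with \<open>q ^ l\<close>.\<close>
  define C where "C = max 1 (fact m / \<gamma> ^ m / q)"
  show thesis
  proof
    show "0 < C" by (simp add: C_def)
    fix t :: ennreal
    assume "t \<noteq> \<infinity>"
    then obtain s where s: "t = ennreal s" "0 \<le> s" by (cases t) auto
    obtain n0 where "s < (1 / \<delta>) ^ n0" using real_arch_pow[of "1 / \<delta>" s] assms by auto
    define n where "n = (LEAST n. s < (1 / \<delta>) ^ n)"
    have n: "s < (1 / \<delta>) ^ n" unfolding n_def by (rule LeastI) fact
    have "exp (- \<gamma> * s powr a) \<le> C * q ^ n"
    proof (cases n)
      case 0
      then show ?thesis using \<open>0 < \<gamma>\<close> by (simp add: C_def max.coboundedI1)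
    next
      case (Suc l)
      then have l: "(1 / \<delta>) ^ l \<le> s" using not_less_Least[of l "\<lambda>n. s < (1 / \<delta>) ^ n"]
        by (auto simp: n_def)
      have "((1 / \<delta>) ^ l) powr a \<le> s powr a" using l assms by (intro powr_mono2) auto
      also have "((1 / \<delta>) ^ l) powr a = (1 / p) ^ l"
        using assms by (simp add: p_def powr_power powr_divide power_divide powr_powr
            flip: powr_realpow) (simp add: mult.commute)
      finally have "exp (- \<gamma> * s powr a) \<le> exp (- (\<gamma> * (1 / p) ^ l))" using \<open>0 < \<gamma>\<close> by simp
      also have "\<dots> \<le> fact m / (\<gamma> * (1 / p) ^ l) ^ m"
        using p \<open>0 < \<gamma>\<close> by (intro exp_minus_le_fact_div_power) auto
      also have "\<dots> = fact m / \<gamma> ^ m * (p ^ m) ^ l"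
        by (simp add: power_mult_distrib power_divide mult.commute flip: power_mult)
      also have "\<dots> \<le> fact m / \<gamma> ^ m * q ^ l"
        using m p \<open>0 < \<gamma>\<close> by (intro mult_left_mono power_mono) auto
      also have "\<dots> = fact m / \<gamma> ^ m / q * q ^ n" using Suc \<open>0 < q\<close> by simp
      also have "\<dots> \<le> C * q ^ n" using \<open>0 < q\<close> by (intro mult_right_mono) (auto simp: C_def)
      finally show ?thesis .
    qed
    then show "\<exists>n. t < ennreal ((1 / \<delta>) ^ n) \<and> exp_decay \<gamma> a t \<le> C * q ^ n"
      using n s by (intro exI[of _ n]) (auto simp: exp_decay_def ennreal_less_iff)
  qed
qed

text \<open>A proportional gap between \<open>u\<close> and \<open>v\<close> forces one between
  their negative powers. For \<open>s\<close>, the \<nu>-th power of \<open>u / v\<close>, the chain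
  \<open>s \<le> exp (- (\<nu> * \<eta>)) \<le> 1 / (1 + \<nu> * \<eta>)\<close> and
  \<open>\<eta> \<le> 1\<close> give
  \<open>1 - s \<ge> \<nu> * \<eta> / (1 + \<nu>)\<close>.\<close>

lemma powr_minus_le_difference:
  fixes u v \<eta> \<nu> :: real
  assumes "0 < u" "0 < v" "0 < \<eta>" "\<eta> \<le> 1" "0 < \<nu>" and "u + \<eta> * v \<le> v"
  shows "u powr (-\<nu>) \<le> (1 + \<nu>) / \<nu> / \<eta> * (u powr (-\<nu>) - v powr (-\<nu>))"
proof -
  define s where "s = u powr \<nu> / v powr \<nu>"
  have pos: "0 < 1 + \<nu> * \<eta>" using assms by (simp add: add_pos_pos)
  have "u \<le> (1 - \<eta>) * v" using assms(6) by (simp add: algebra_simps)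
  also have "\<dots> \<le> exp (- \<eta>) * v"
    using exp_ge_add_one_self[of "- \<eta>"] \<open>0 < v\<close> by (intro mult_right_mono) auto
  finally have "u powr \<nu> \<le> (exp (- \<eta>) * v) powr \<nu>" using assms by (intro powr_mono2) auto
  also have "\<dots> = exp (- (\<nu> * \<eta>)) * v powr \<nu>"
    using assms by (simp add: powr_mult exp_powr_real mult.commute)
  finally have "s \<le> exp (- (\<nu> * \<eta>))" using assms by (simp add: s_def field_simps)
  also have "\<dots> \<le> 1 / (1 + \<nu> * \<eta>)"
    using pos by (simp add: exp_minus inverse_eq_divide frac_le)
  finally have "s * (1 + \<nu> * \<eta>) \<le> 1"
    using pos by (simp add: pos_le_divide_eq)
  moreover have "0 < s" "\<nu> * \<eta> \<le> \<nu>" using assms by (auto simp: s_def)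
  ultimately have "\<nu> * \<eta> \<le> (1 + \<nu>) * (1 - s)"
  proof -
    have "\<nu> * \<eta> * s \<le> 1 - s" using \<open>s * (1 + \<nu> * \<eta>) \<le> 1\<close> by (simp add: algebra_simps)
    moreover have "0 \<le> \<nu> * \<eta> * s" using \<open>0 < s\<close> assms by simp
    ultimately have "0 \<le> 1 - s" by linarith
    then have "\<nu> * \<eta> * (1 - s) \<le> \<nu> * (1 - s)" using \<open>\<nu> * \<eta> \<le> \<nu>\<close> by (intro mult_right_mono)
    then show ?thesis using \<open>\<nu> * \<eta> * s \<le> 1 - s\<close> by (simp add: algebra_simps)
  qed
  then have "1 \<le> (1 + \<nu>) / \<nu> / \<eta> * (1 - s)" using assms by (simp add: field_simps)
  then have "u powr (-\<nu>) * 1 \<le> u powr (-\<nu>) * ((1 + \<nu>) / \<nu> / \<eta> * (1 - s))"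
    by (intro mult_left_mono) auto
  also have "\<dots> = (1 + \<nu>) / \<nu> / \<eta> * (u powr (-\<nu>) - u powr (-\<nu>) * s)"
    by (simp only: right_diff_distrib left_diff_distrib mult_1_right mult_1_left mult_ac)
  also have "u powr (-\<nu>) * s = v powr (-\<nu>)" using assms by (simp add: s_def powr_minus_divide)
  finally show ?thesis by simp
qed

section \<open>Volumes of balls under doubling\<close>

context homogeneous_type
begin

abbreviation V :: "'a \<Rightarrow> real \<Rightarrow> real" where
  "V \<equiv> Vol X d M"

lemma ball_fmeasurable:
  assumes "x \<in> X" "0 < r"
  shows "qball X d x r \<in> fmeasurable M"
proof (rule fmeasurableI)
  show "qball X d x r \<in> sets M" using assms by (simp add: ball_borel)
  \<comment> \<open>Doubling at radius \<open>r / 2\<close> bounds this measure by the quantity that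
    \<open>ball_finite\<close> makes finite.\<close>
  show "emeasure M (qball X d x r) < \<infinity>"
    using doubling[of x "r / 2"] ball_finite[of x "r / 2"] assms by auto
qed

lemma Vol_pos:
  assumes "x \<in> X" "0 < r"
  shows "0 < V x r"
proof -
  have "emeasure M (qball X d x r) = ennreal (V x r)"
    unfolding Vol_def using ball_fmeasurable[OF assms]
    by (intro emeasure_eq_measure2) 
  then show ?thesis using ball_pos[of x "r / 2"] assms by simp
qed

lemma measure_le_Vol:
  assumes "x \<in> X" "0 < r" "A \<in> sets M" "A \<subseteq> qball X d x r"
  shows "measure M A \<le> V x r"
  unfolding Vol_def using assms by (intro measure_mono_fmeasurable ball_fmeasurable)

lemma Vol_mono:
  assumes "x \<in> X" "0 < r" "r \<le> s"
  shows "V x r \<le> V x s"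
  unfolding Vol_def[of _ _ _ _ r] using assms
  by (intro measure_le_Vol) (auto simp: ball_borel, auto simp: qball_def)

lemma Vol_doubling:
  assumes "x \<in> X" "0 < r"
  shows "V x (2 * r) \<le> max 1 C\<mu> * V x r"
proof -
  have "ennreal (V x (2 * r)) \<le> ennreal C\<mu> * ennreal (V x r)"
    using doubling[OF assms] assms ball_fmeasurable
    by (simp add: Vol_def flip: emeasure_eq_measure2)
  \<comment> \<open>\<open>ennreal\<close> truncates a negative constant to 0; with
    \<open>max 1 C\<mu>\<close> the product can be moved inside \<open>ennreal\<close>, and all
    powers of the constant are at least 1.\<close>
  also have "\<dots> \<le> ennreal (max 1 C\<mu>) * ennreal (V x r)"
    by (intro mult_right_mono ennreal_leI) auto
  also have "\<dots> = ennreal (max 1 C\<mu> * V x r)"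
    by (rule ennreal_mult'[symmetric]) simp
  finally show ?thesis using Vol_pos[OF assms]
    by (subst (asm) ennreal_le_iff) (auto intro!: mult_nonneg_nonneg)
qed

lemma Vol_iterated_doubling:
  assumes "x \<in> X" "0 < r"
  shows "V x (2 ^ j * r) \<le> max 1 C\<mu> ^ j * V x r"
proof (induction j)
  case (Suc j)
  have "V x (2 ^ Suc j * r) = V x (2 * (2 ^ j * r))" by (simp add: mult_ac)
  also have "\<dots> \<le> max 1 C\<mu> * V x (2 ^ j * r)" using assms by (intro Vol_doubling) auto
  also have "\<dots> \<le> max 1 C\<mu> * (max 1 C\<mu> ^ j * V x r)"
    using Suc.IH by (intro mult_left_mono) auto
  finally show ?case by (simp add: mult_ac)
qed simp

lemma Vol_scaling:
  assumes "0 < \<delta>"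
  obtains \<Lambda> where "1 \<le> \<Lambda>"
    and "\<And>x k n. x \<in> X \<Longrightarrow> V x (\<delta> powi (k - int n)) \<le> \<Lambda> ^ n * V x (\<delta> powi k)"
proof -
  \<comment> \<open>\<open>j\<close> doublings enlarge a radius by more than
    \<open>1 / \<delta>\<close>, so \<open>\<Lambda>\<close> pays for one dyadic scale, uniformly in
    the centre and the scale.\<close>
  obtain j where j: "1 / \<delta> < 2 ^ j" using real_arch_pow[of 2 "1 / \<delta>"] by auto
  define \<Lambda> where "\<Lambda> = max 1 C\<mu> ^ j"
  have "1 \<le> \<Lambda>" by (simp add: \<Lambda>_def)
  moreover have "V x (\<delta> powi (k - int n)) \<le> \<Lambda> ^ n * V x (\<delta> powi k)" if "x \<in> X" for x k n
  proof (induction n)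
    case (Suc n)
    have "\<delta> powi (k - int (Suc n)) = 1 / \<delta> * \<delta> powi (k - int n)"
      using \<open>0 < \<delta>\<close> power_int_add_1[of \<delta> "k - int (Suc n)"] by (simp add: algebra_simps)
    also have "\<dots> \<le> 2 ^ j * \<delta> powi (k - int n)"
      using \<open>0 < \<delta>\<close> j by (intro mult_right_mono) auto
    finally have "V x (\<delta> powi (k - int (Suc n))) \<le> V x (2 ^ j * \<delta> powi (k - int n))"
      using \<open>0 < \<delta>\<close> \<open>x \<in> X\<close> by (intro Vol_mono) auto
    also have "\<dots> \<le> \<Lambda> * V x (\<delta> powi (k - int n))"
      unfolding \<Lambda>_def using \<open>0 < \<delta>\<close> \<open>x \<in> X\<close> by (intro Vol_iterated_doubling) auto
    also have "\<dots> \<le> \<Lambda> * (\<Lambda> ^ n * V x (\<delta> powi k))"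
      using Suc.IH \<open>1 \<le> \<Lambda>\<close> by (intro mult_left_mono) auto
    finally show ?case by (simp add: mult_ac)
  qed simp
  ultimately show thesis by (rule that)
qed

end

section \<open>Separation and density of the dyadic points\<close>

context dyadic_points
begin

text \<open>The forms in which smallness of \<delta> is used: one dyadic scale absorbs the constants
  from two applications of the quasi-triangle inequality, or from one.\<close>

lemma \<delta>_A0_le: "4 * A0\<^sup>2 * \<delta> \<le> 1" "4 * A0 * \<delta> \<le> 1"
proof -
  have "A0 ^ 2 \<le> A0 ^ 10" using A0_ge_1 by (intro power_increasing) auto
  moreover have "\<delta> * A0 ^ 10 \<le> 1 / 1000"
    using \<delta>_small A0_ge_1 by (simp add: power_int_minus field_simps)
  moreover have "\<delta> * A0 ^ 2 \<le> \<delta> * A0 ^ 10"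
    using calculation(1) \<delta>_pos by (intro mult_left_mono) auto
  ultimately show le: "4 * A0\<^sup>2 * \<delta> \<le> 1" by (simp add: mult_ac)
  have "A0 * \<delta> \<le> A0\<^sup>2 * \<delta>" using A0_ge_1 \<delta>_pos by (simp add: power2_eq_square)
  with le show "4 * A0 * \<delta> \<le> 1" by linarith
qed

lemma powi_mono: "k \<le> l \<Longrightarrow> \<delta> powi l \<le> \<delta> powi k"
  using \<delta>_pos \<delta>_less_1 by (intro power_int_decreasing) auto

lemma powi_add_1: "\<delta> powi (k + 1) = \<delta> * \<delta> powi k"
  using \<delta>_pos by (simp add: power_int_add)

text \<open>Otherwise \<open>insert y S\<close> would be a larger separated subset of
  \<open>E\<close>.\<close>

lemma maximal_separated_near:
  assumes "maximal_separated d r E S" "E \<subseteq> X" "y \<in> E" "y \<notin> S"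
  shows "\<exists>z\<in>S. d y z < r"
proof (rule ccontr)
  assume "\<not> ?thesis"
  then have far: "\<And>z. z \<in> S \<Longrightarrow> r \<le> d y z \<and> r \<le> d z y"
    using assms sym unfolding maximal_separated_def by (metis linorder_not_less subsetD)
  then have "separated d r (insert y S)"
    using assms(1) unfolding maximal_separated_def separated_def by blast
  then show False
    using assms unfolding maximal_separated_def by blast
qed

text \<open>Merges the three construction hypotheses. At negative levels maximality is relative to
  the next finer level, which suffices for new points because they lie in
  \<open>P (k + 1)\<close>.\<close>

lemma level_maximal:
  "maximal_separated d (\<delta> powi k) (if 0 \<le> k then X else P (k + 1)) (P k)"
  using level_0 pos_maximal[of k] neg_maximal[of "- k"]
  by (cases "k = 0") (auto simp: algebra_simps)

lemma level_nested: "P k \<subseteq> P (k + 1)"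
  using pos_nested[of "k + 1"] level_maximal[of k]
  by (cases "0 \<le> k") (auto simp: maximal_separated_def)

lemma level_subset: "P k \<subseteq> X"
proof (cases "0 \<le> k")
  case True
  then show ?thesis using level_maximal[of k] by (simp add: maximal_separated_def)
next
  case False
  then have "k \<le> 0" by simp
  then show ?thesis
  proof (induction k rule: int_le_induct)
    case base
    then show ?case using level_0 by (simp add: maximal_separated_def)
  next
    case (step i)
    then show ?case using level_nested[of "i - 1"] by simp
  qed
qed

text \<open>Maximality of \<open>P k\<close> yields a point \<open>z\<close> of \<open>P k\<close>
  near \<open>y\<close>; by nesting both lie in \<open>P (k + 1)\<close>, whose separation keeps
  them apart.\<close>

lemma new_point_partner:
  assumes "y \<in> new_points P k"
  obtains z where "z \<in> X" "\<delta> powi (k + 1) \<le> d y z" "d y z < \<delta> powi k"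
proof -
  have y: "y \<in> P (k + 1)" "y \<notin> P k" using assms by (auto simp: new_points_def)
  then obtain z where z: "z \<in> P k" "d y z < \<delta> powi k"
    using maximal_separated_near[OF level_maximal[of k], of y] level_subset[of "k + 1"]
    by (cases "0 \<le> k") auto
  have "\<delta> powi (k + 1) \<le> d y z"
  proof -
    have "separated d (\<delta> powi (k + 1)) (P (k + 1))"
      using level_maximal[of "k + 1"] unfolding maximal_separated_def by (elim conjE)
    moreover have "z \<in> P (k + 1)" "y \<noteq> z" using y z level_nested[of k] by auto
    ultimately show ?thesis using y unfolding separated_def by simp
  qed
  then show thesis using that z level_subset by blast
qed

text \<open>The new point \<open>y\<close> may coincide with \<open>x\<close>, so \<open>w\<close>
  is either \<open>y\<close> or its partner \<open>z\<close>. Both are within the outer radius, and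
  their mutual distance prevents both from being too close to \<open>x\<close>.\<close>

lemma annulus_point:
  assumes "x \<in> X" and "y \<in> new_points P k" and "d x y < \<delta> powi (k - int n)"
  obtains w where "w \<in> X" "\<delta> powi (k + 1) / (2 * A0) \<le> d x w"
    "d x w \<le> 2 * A0 * \<delta> powi (k - int n)"
proof -
  define D where "D = \<delta> powi (k - int n)"
  have "0 < D" using \<delta>_pos by (simp add: D_def)
  have "y \<in> X" using assms(2) level_subset by (auto simp: new_points_def)
  obtain z where z: "z \<in> X" "\<delta> powi (k + 1) \<le> d y z" "d y z < \<delta> powi k"
    using new_point_partner[OF assms(2)] .
  have kD: "\<delta> powi k \<le> D" unfolding D_def by (intro powi_mono) simp
  have "d x y < D" using assms by (simp add: D_def)
  have "d x y \<le> 2 * A0 * D" using \<open>d x y < D\<close> A0_ge_1 \<open>0 < D\<close>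
      mult_right_mono[of 1 A0 D] by linarith
  moreover have "d x z \<le> 2 * A0 * D"
  proof -
    have "d x z \<le> A0 * (d x y + d y z)" using quasi_triangle \<open>x \<in> X\<close> \<open>y \<in> X\<close> z by blast
    also have "\<dots> \<le> A0 * (D + D)"
      using \<open>d x y < D\<close> z kD A0_ge_1 by (intro mult_left_mono add_mono) auto
    finally show ?thesis by simp
  qed
  moreover have "\<delta> powi (k + 1) / (2 * A0) \<le> d x y \<or> \<delta> powi (k + 1) / (2 * A0) \<le> d x z"
  proof (rule ccontr)
    assume "\<not> ?thesis"
    then have "A0 * (d x y + d x z) < A0 * (2 * (\<delta> powi (k + 1) / (2 * A0)))"
      using A0_ge_1 by (intro mult_strict_left_mono) auto
    also have "\<dots> = \<delta> powi (k + 1)" using A0_ge_1 by simp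
    finally show False
      using z quasi_triangle[of y z x] sym[of x y] \<open>x \<in> X\<close> \<open>y \<in> X\<close> by simp
  qed
  ultimately show thesis using that \<open>y \<in> X\<close> z unfolding D_def by blast
qed

end

section \<open>Volume gain near new points and summation over scales\<close>

locale dyadic_homogeneous_type = homogeneous_type X d A0 M C\<mu> + dyadic_points X d A0 \<delta> P
  for X :: "'a set" and d :: "'a \<Rightarrow> 'a \<Rightarrow> real" and A0 :: real and M :: "'a measure"
    and C\<mu> :: real and \<delta> :: real and P :: "int \<Rightarrow> 'a set"
begin

text \<open>Disjoint balls of equal radius around \<open>x\<close> and an annulus point both fit
  into the large ball around \<open>x\<close>. The inequality has the shape of the gap hypothesis of
  \<open>powr_minus_le_difference\<close>, with
  \<open>\<eta> = 1 / \<Lambda> ^ (n + 4)\<close>.\<close>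

lemma Vol_growth:
  assumes scaling:
      "\<And>x k n. x \<in> X \<Longrightarrow> V x (\<delta> powi (k - int n)) \<le> \<Lambda> ^ n * V x (\<delta> powi k)"
    and "1 \<le> \<Lambda>" and "x \<in> X" and "y \<in> new_points P k" and "d x y < \<delta> powi (k - int n)"
  shows "V x (\<delta> powi (k + 2)) + 1 / \<Lambda> ^ (n + 4) * V x (\<delta> powi (k - int n - 1))
    \<le> V x (\<delta> powi (k - int n - 1))"
proof -
  define D s R where "D = \<delta> powi (k - int n)" and "s = \<delta> powi (k + 2)"
    and "R = \<delta> powi (k - int n - 1)"
  have pos: "0 < D" "0 < s" "0 < R" using \<delta>_pos by (auto simp: D_def s_def R_def)
  obtain w where w: "w \<in> X" "\<delta> powi (k + 1) / (2 * A0) \<le> d x w" "d x w \<le> 2 * A0 * D"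
    using annulus_point[OF assms(3-5)] unfolding D_def .
  \<comment> \<open>The radius \<open>s\<close> lies one scale below the separation of
    \<open>P (k + 1)\<close>, small enough that \<open>2 * A0 * s\<close> stays below
    \<open>d x w\<close>; this makes the two small balls disjoint.\<close>
  have "s = \<delta> * \<delta> powi (k + 1)" using powi_add_1[of "k + 1"] by (simp add: s_def add.assoc)
  then have "4 * A0\<^sup>2 * s \<le> \<delta> powi (k + 1)"
    using mult_right_mono[OF \<delta>_A0_le(1), of "\<delta> powi (k + 1)"] \<delta>_pos by (simp add: mult_ac)
  then have "2 * A0 * s \<le> \<delta> powi (k + 1) / (2 * A0)"
    using A0_ge_1 by (simp add: field_simps power2_eq_square)
  then have far: "2 * A0 * s \<le> d x w" using w by simp
  have DR: "D = \<delta> * R" using powi_add_1[of "k - int n - 1"] by (simp add: D_def R_def)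
  have A2D: "4 * A0\<^sup>2 * D \<le> R" and AD: "4 * A0 * D \<le> R"
    using mult_right_mono[OF \<delta>_A0_le(1), of R] mult_right_mono[OF \<delta>_A0_le(2), of R] pos
    by (simp_all add: DR mult_ac)
  have sD: "s \<le> D" unfolding s_def D_def by (intro powi_mono) simp
  have AA: "A0 * D \<le> A0\<^sup>2 * D" "D \<le> A0 * D"
    using A0_ge_1 pos by (auto simp: power2_eq_square)
  define B where "B = qball X d x s"
  define B' where "B' = qball X d w s"
  have meas: "B \<in> fmeasurable M" "B' \<in> fmeasurable M"
    using ball_fmeasurable pos \<open>x \<in> X\<close> w by (auto simp: B_def B'_def)
  have "B \<inter> B' = {}"
  proof (rule ccontr)
    assume "B \<inter> B' \<noteq> {}"
    then obtain u where u: "u \<in> X" "d x u < s" "d w u < s" by (auto simp: B_def B'_def qball_def)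
    have "d x w \<le> A0 * (d x u + d u w)" using quasi_triangle u w \<open>x \<in> X\<close> by blast
    also have "\<dots> < A0 * (s + s)"
      using u sym[of u w] w A0_ge_1 by (intro mult_strict_left_mono) auto
    finally show False using far by simp
  qed
  moreover have "B \<subseteq> qball X d x R"
  proof -
    have "s \<le> R" using sD AA A2D pos by linarith
    then show ?thesis by (auto simp: B_def qball_def)
  qed
  moreover have "B' \<subseteq> qball X d x R"
  proof
    fix u assume "u \<in> B'"
    then have u: "u \<in> X" "d w u < s" by (auto simp: B'_def qball_def)
    have "d x u \<le> A0 * (d x w + d w u)" using quasi_triangle u w \<open>x \<in> X\<close> by blast
    also have "\<dots> < A0 * (2 * A0 * D + D)"
      using u w sD A0_ge_1 by (intro mult_strict_left_mono) auto
    also have "\<dots> = 2 * (A0\<^sup>2 * D) + A0 * D" by (simp add: algebra_simps power2_eq_square)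
    also have "\<dots> \<le> R" using A2D AA pos by linarith
    finally show "u \<in> qball X d x R" using u by (simp add: qball_def)
  qed
  ultimately have disj: "V x s + V w s \<le> V x R"
    using measure_le_Vol[OF \<open>x \<in> X\<close> \<open>0 < R\<close>, of "B \<union> B'"] measure_Un3[of B M B'] meas
    by (simp add: Vol_def B_def B'_def fmeasurableD)
  \<comment> \<open>One scale coarser than \<open>R\<close>, the ball around \<open>w\<close>
    swallows the one around \<open>x\<close>; what remains is a comparison of concentric balls,
    where scaling applies.\<close>
  define R' where "R' = \<delta> powi (k - int n - 2)"
  have "R = \<delta> * R'" using powi_add_1[of "k - int n - 2"] by (simp add: R_def R'_def)
  then have AR: "4 * A0 * R \<le> R'" 
    using mult_right_mono[OF \<delta>_A0_le(2), of R'] \<delta>_pos by (simp add: mult_ac R'_def)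
  have "qball X d x R \<subseteq> qball X d w R'"
  proof
    fix u assume "u \<in> qball X d x R"
    then have u: "u \<in> X" "d x u < R" by (auto simp: qball_def)
    have "d w u \<le> A0 * (d w x + d x u)" using quasi_triangle u w \<open>x \<in> X\<close> by blast
    also have "\<dots> < A0 * (R + R)"
      using u w sym[of w x] \<open>x \<in> X\<close> AD A0_ge_1 pos by (intro mult_strict_left_mono) auto
    also have "\<dots> \<le> R'" using AR mult_right_mono[OF A0_ge_1, of R] pos by argo
    finally show "u \<in> qball X d w R'" using u by (simp add: qball_def)
  qed
  then have "V x R \<le> V w R'"
    unfolding Vol_def[of _ _ _ x] using w \<open>x \<in> X\<close> \<delta>_pos
    by (intro measure_le_Vol) (auto simp: ball_borel R'_def)
  \<comment> \<open>There are \<open>n + 4\<close> scales between the exponents \<open>k + 2\<close>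
    and \<open>k - n - 2\<close>.\<close>
  also have "\<dots> \<le> \<Lambda> ^ (n + 4) * V w s"
    using scaling[OF \<open>w \<in> X\<close>, of "k + 2" "n + 4"] by (simp add: R'_def s_def)
  finally have "1 / \<Lambda> ^ (n + 4) * V x R \<le> V w s"
    using \<open>1 \<le> \<Lambda>\<close> by (simp add: field_simps)
  then show ?thesis using disj by (simp add: s_def R_def)
qed

lemma Vol_powr_le_difference:
  assumes scaling:
      "\<And>x k n. x \<in> X \<Longrightarrow> V x (\<delta> powi (k - int n)) \<le> \<Lambda> ^ n * V x (\<delta> powi k)"
    and "1 \<le> \<Lambda>" and "0 < \<nu>" and "x \<in> X"
    and "y \<in> new_points P k" and "d x y < \<delta> powi (k - int n)"
  shows "V x (\<delta> powi k) powr (-\<nu>) \<le> (1 + \<nu>) / \<nu> * \<Lambda> ^ (n + 4)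
    * (V x (\<delta> powi (k + 2)) powr (-\<nu>) - V x (\<delta> powi (k - int n - 1)) powr (-\<nu>))"
proof -
  have "V x (\<delta> powi k) powr (-\<nu>) \<le> V x (\<delta> powi (k + 2)) powr (-\<nu>)"
    using \<delta>_pos \<open>x \<in> X\<close> \<open>0 < \<nu>\<close> by (intro powr_mono2' Vol_mono Vol_pos powi_mono) auto
  also have "\<dots> \<le> (1 + \<nu>) / \<nu> / (1 / \<Lambda> ^ (n + 4))
    * (V x (\<delta> powi (k + 2)) powr (-\<nu>) - V x (\<delta> powi (k - int n - 1)) powr (-\<nu>))"
    using Vol_growth[OF scaling \<open>1 \<le> \<Lambda>\<close> assms(4-6)] \<delta>_pos assms
    by (intro powr_minus_le_difference Vol_pos) (auto simp: divide_simps)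
  finally show ?thesis by simp
qed

text \<open>The shift \<open>n\<close> may depend on \<open>x\<close> and \<open>k\<close>, the
  constant may not; the factor \<open>(1 / 4) ^ n\<close> is the weight of the summation
  lemma.\<close>

lemma term_le_difference:
  assumes "0 < \<gamma>" "0 < \<nu>" "0 < a"
  obtains C where "0 < C"
    and "\<And>x k. x \<in> X \<Longrightarrow> \<exists>n. V x (\<delta> powi k) powr (-\<nu>)
        * exp_decay \<gamma> a (ennreal (\<delta> powi (-k)) * set_dist d x (new_points P k))
      \<le> C * ((1 / 4) ^ n
        * (V x (\<delta> powi (k + 2)) powr (-\<nu>) - V x (\<delta> powi (k - int n - 1)) powr (-\<nu>)))"
proof -
  obtain \<Lambda> where "1 \<le> \<Lambda>"
    and scaling: "\<And>x k n. x \<in> X \<Longrightarrow> V x (\<delta> powi (k - int n)) \<le> \<Lambda> ^ n * V x (\<delta> powi k)"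
    using Vol_scaling[OF \<delta>_pos] by blast
  \<comment> \<open>With this decay ratio, \<open>\<Lambda> ^ n\<close> from the volume comparison
    cancels and \<open>(1 / 4) ^ n\<close> remains.\<close>
  have "0 < 1 / (4 * \<Lambda>)" using \<open>1 \<le> \<Lambda>\<close> by simp
  then obtain C1 where "0 < C1"
    and C1: "\<And>t. t \<noteq> \<infinity> \<Longrightarrow>
      \<exists>n. t < ennreal ((1 / \<delta>) ^ n) \<and> exp_decay \<gamma> a t \<le> C1 * (1 / (4 * \<Lambda>)) ^ n"
    using exp_decay_geometric[OF \<delta>_pos \<delta>_less_1 \<open>0 < \<gamma>\<close> \<open>0 < a\<close>] by metis
  define C where "C = C1 * ((1 + \<nu>) / \<nu> * \<Lambda> ^ 4)"
  have "0 < C" using \<open>0 < C1\<close> \<open>1 \<le> \<Lambda>\<close> \<open>0 < \<nu>\<close> by (simp add: C_def)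
  moreover have "\<exists>n. V x (\<delta> powi k) powr (-\<nu>)
        * exp_decay \<gamma> a (ennreal (\<delta> powi (-k)) * set_dist d x (new_points P k))
      \<le> C * ((1 / 4) ^ n
        * (V x (\<delta> powi (k + 2)) powr (-\<nu>) - V x (\<delta> powi (k - int n - 1)) powr (-\<nu>)))"
    if "x \<in> X" for x k
  proof -
    define t where "t = ennreal (\<delta> powi (-k)) * set_dist d x (new_points P k)"
    show ?thesis
    proof (cases "t = \<infinity>")
      \<comment> \<open>This is the case of no new points: the term vanishes, and any
        \<open>n\<close> works since the difference is nonnegative.\<close>
      case True
      have "V x (\<delta> powi (k - int 0 - 1)) powr (-\<nu>) \<le> V x (\<delta> powi (k + 2)) powr (-\<nu>)"
        using \<delta>_pos \<open>x \<in> X\<close> \<open>0 < \<nu>\<close> by (intro powr_mono2' Vol_mono Vol_pos powi_mono) auto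
      then show ?thesis using True \<open>0 < C\<close> unfolding t_def[symmetric]
        by (intro exI[of _ 0]) (simp add: exp_decay_def)
    next
      case False
      then obtain n where n: "t < ennreal ((1 / \<delta>) ^ n)"
        "exp_decay \<gamma> a t \<le> C1 * (1 / (4 * \<Lambda>)) ^ n" using C1 by blast
      \<comment> \<open>Undoing the normalization turns the bound on \<open>t\<close> into a strict
        bound on the distance, which some new point realizes even if the infimum is not
        attained.\<close>
      have "ennreal (\<delta> powi k) * t < ennreal (\<delta> powi k) * ennreal ((1 / \<delta>) ^ n)"
        using n(1) \<delta>_pos by (intro ennreal_mult_strict_left_mono) auto
      also have "\<dots> = ennreal (\<delta> powi (k - int n))"
        using \<delta>_pos by (simp add: power_int_diff power_divide flip: ennreal_mult')
      also have "ennreal (\<delta> powi k) * t = set_dist d x (new_points P k)"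
        using \<delta>_pos unfolding t_def mult.assoc[symmetric]
        by (simp add: power_int_minus flip: ennreal_mult')
      finally obtain y where y: "y \<in> new_points P k" "d x y < \<delta> powi (k - int n)"
        unfolding set_dist_def INF_less_iff by (meson ennreal_leI linorder_not_le)
      let ?\<Delta> = "V x (\<delta> powi (k + 2)) powr (-\<nu>) - V x (\<delta> powi (k - int n - 1)) powr (-\<nu>)"
      have le: "V x (\<delta> powi k) powr (-\<nu>) \<le> (1 + \<nu>) / \<nu> * \<Lambda> ^ (n + 4) * ?\<Delta>"
        using Vol_powr_le_difference[OF scaling \<open>1 \<le> \<Lambda>\<close> \<open>0 < \<nu>\<close> \<open>x \<in> X\<close> y] by simp
      \<comment> \<open>Multiplying the two bounds needs the first one nonnegative; this follows
        from \<open>le\<close>, whose left side is a power.\<close>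
      then have "V x (\<delta> powi k) powr (-\<nu>) * exp_decay \<gamma> a t
          \<le> ((1 + \<nu>) / \<nu> * \<Lambda> ^ (n + 4) * ?\<Delta>) * (C1 * (1 / (4 * \<Lambda>)) ^ n)"
        using n(2) by (intro mult_mono order_trans[OF powr_ge_zero le]) (auto simp: exp_decay_def)
      also have "\<dots> = C * ((1 / 4) ^ n * ?\<Delta>)"
        using \<open>1 \<le> \<Lambda>\<close> by (simp add: C_def power_add power_mult_distrib power_divide)
      finally show ?thesis unfolding t_def by blast
    qed
  qed
  ultimately show thesis by (rule that)
qed

text \<open>The constant is uniform in the finite set \<open>F\<close>, so the bound passes to the
  infinite sum.\<close>

lemma sum_terms_le:
  assumes "0 < \<gamma>" "0 < \<nu>" "0 < a"
  shows "\<exists>C>0. \<forall>x\<in>X. \<forall>r>0. \<forall>F. finite F \<longrightarrow> F \<subseteq> {k. r \<le> \<delta> powi k} \<longrightarrow>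
    (\<Sum>k\<in>F. V x (\<delta> powi k) powr (-\<nu>)
       * exp_decay \<gamma> a (ennreal (\<delta> powi (-k)) * set_dist d x (new_points P k)))
    \<le> C * V x r powr (-\<nu>)"
proof -
  obtain \<Lambda> where "1 \<le> \<Lambda>"
    and scaling: "\<And>x k n. x \<in> X \<Longrightarrow> V x (\<delta> powi (k - int n)) \<le> \<Lambda> ^ n * V x (\<delta> powi k)"
    using Vol_scaling[OF \<delta>_pos] by blast
  define T where "T x k = V x (\<delta> powi k) powr (-\<nu>)
    * exp_decay \<gamma> a (ennreal (\<delta> powi (-k)) * set_dist d x (new_points P k))" for x k
  define W where "W x k = V x (\<delta> powi k) powr (-\<nu>)" for x k
  obtain C where "0 < C"
    and C: "\<And>x k. x \<in> X \<Longrightarrow> \<exists>n. T x k \<le> C * ((1 / 4) ^ n * (W x (k + 2) - W x (k - int n - 1)))"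
    using term_le_difference[OF assms] unfolding T_def W_def by metis
  have bound: "(\<Sum>k\<in>F. T x k) \<le> (C * 6 * \<Lambda> powr (2 * \<nu>)) * V x r powr (-\<nu>)"
    if "x \<in> X" "0 < r" "finite F" "F \<subseteq> {k. r \<le> \<delta> powi k}" for x r F
  proof (cases "F = {}")
    case True
    then show ?thesis using \<open>0 < C\<close> by simp
  next
    case False
    \<comment> \<open>The finest scale in \<open>F\<close>: telescoping ends at
      \<open>W x (K + 2)\<close>, and \<open>r \<le> \<delta> powi K\<close> ties this value to
      \<open>V x r\<close>.\<close>
    define K where "K = Max F"
    have "F \<subseteq> {..K}" "K \<in> F" using \<open>finite F\<close> False by (auto simp: K_def)
    then have "r \<le> \<delta> powi K" using that by auto
    have "mono (W x)"
      unfolding W_def using \<delta>_pos \<open>x \<in> X\<close> \<open>0 < \<nu>\<close>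
      by (intro monoI powr_mono2' Vol_mono Vol_pos powi_mono) auto
    have "0 \<le> W x k" for k by (simp add: W_def)
    obtain n where n: "\<And>k. T x k \<le> C * ((1 / 4) ^ n k * (W x (k + 2) - W x (k - int (n k) - 1)))"
      using C[OF \<open>x \<in> X\<close>] by metis
    have "(\<Sum>k\<in>F. T x k) \<le> C * (\<Sum>k\<in>F. (1 / 4) ^ n k * (W x (k + 2) - W x (k - int (n k) - 1)))"
      unfolding sum_distrib_left by (intro sum_mono n)
    also have "\<dots> \<le> C * (6 * W x (K + 2))"
      using \<open>0 < C\<close> \<open>mono (W x)\<close> \<open>\<And>k. 0 \<le> W x k\<close> \<open>finite F\<close> \<open>F \<subseteq> {..K}\<close>
      by (intro mult_left_mono sum_weighted_shift_difference_le) auto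
    also have "W x (K + 2) \<le> \<Lambda> powr (2 * \<nu>) * V x r powr (-\<nu>)"
    proof -
      \<comment> \<open>The two scales from \<open>K\<close> to \<open>K + 2\<close> cost
        \<open>\<Lambda>\<close> squared in volume, hence the factor
        \<open>\<Lambda> powr (2 * \<nu>)\<close>.\<close>
      have "V x r \<le> V x (\<delta> powi K)" using \<open>x \<in> X\<close> \<open>0 < r\<close> \<open>r \<le> \<delta> powi K\<close> by (rule Vol_mono)
      also have "\<dots> \<le> \<Lambda>\<^sup>2 * V x (\<delta> powi (K + 2))"
        using scaling[OF \<open>x \<in> X\<close>, of "K + 2" 2] by simp
      finally have "(\<Lambda>\<^sup>2 * V x (\<delta> powi (K + 2))) powr (-\<nu>) \<le> V x r powr (-\<nu>)"
        using Vol_pos \<open>x \<in> X\<close> \<open>0 < r\<close> \<open>0 < \<nu>\<close> by (intro powr_mono2') auto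
      moreover have "(\<Lambda>\<^sup>2 * V x (\<delta> powi (K + 2))) powr (-\<nu>) = \<Lambda> powr (- (2 * \<nu>)) * W x (K + 2)"
        using \<open>1 \<le> \<Lambda>\<close> Vol_pos[of x "\<delta> powi (K + 2)"] \<open>x \<in> X\<close> \<delta>_pos
        by (simp add: W_def powr_mult powr_powr flip: powr_numeral)
      ultimately have "\<Lambda> powr (2 * \<nu>) * (\<Lambda> powr (- (2 * \<nu>)) * W x (K + 2))
          \<le> \<Lambda> powr (2 * \<nu>) * V x r powr (-\<nu>)"
        by (intro mult_left_mono) auto
      then show ?thesis
        using \<open>1 \<le> \<Lambda>\<close> by (simp flip: powr_add mult.assoc)
    qed
    finally show ?thesis using \<open>0 < C\<close> by (simp add: mult_ac)
  qed
  have "0 < C * 6 * \<Lambda> powr (2 * \<nu>)" using \<open>0 < C\<close> \<open>1 \<le> \<Lambda>\<close> by simp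
  with bound show ?thesis unfolding T_def by blast
qed

end

theorem lemma8p3:
  fixes X :: "'a set" and d :: "'a \<Rightarrow> 'a \<Rightarrow> real" and A0 C\<mu> \<delta> \<gamma> \<nu> a :: real
    and M :: "'a measure" and P :: "int \<Rightarrow> 'a set"
  assumes "homogeneous_type X d A0 M C\<mu>"
    and "dyadic_points X d A0 \<delta> P"
    and "\<gamma> > 0" and "\<nu> > 0" and "a > 0"
  shows "\<exists>C>0. \<forall>x\<in>X. \<forall>r>0.
    (\<Sum>\<^sub>\<infinity>k\<in>{k::int. \<delta> powi k \<ge> r}.
       ennreal (Vol X d M x (\<delta> powi k) powr (-\<nu>)
         * exp_decay \<gamma> a (ennreal (\<delta> powi (-k)) * set_dist d x (new_points P k))))
    \<le> ennreal (C * Vol X d M x r powr (-\<nu>))"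
proof -
  interpret dyadic_homogeneous_type X d A0 M C\<mu> \<delta> P
    using assms by (simp add: dyadic_homogeneous_type_def)
  obtain C where "0 < C" and C: "\<And>x r F. x \<in> X \<Longrightarrow> 0 < r \<Longrightarrow> finite F \<Longrightarrow> F \<subseteq> {k. r \<le> \<delta> powi k} \<Longrightarrow>
    (\<Sum>k\<in>F. V x (\<delta> powi k) powr (-\<nu>)
       * exp_decay \<gamma> a (ennreal (\<delta> powi (-k)) * set_dist d x (new_points P k)))
    \<le> C * V x r powr (-\<nu>)"
    using sum_terms_le[OF assms(3-5)] by auto
  show ?thesis
  \<comment> \<open>In \<open>ennreal\<close> every family is summable, and a common bound on the
    finite partial sums bounds the infinite sum.\<close>
  proof (intro exI[of _ C] conjI ballI allI impI infsum_le_finite_sums)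
    fix x r F
    assume "x \<in> X" "0 < r" "finite F" "F \<subseteq> {k. r \<le> \<delta> powi k}"
    from C[OF this]
    show "(\<Sum>k\<in>F. ennreal (V x (\<delta> powi k) powr (-\<nu>)
         * exp_decay \<gamma> a (ennreal (\<delta> powi (-k)) * set_dist d x (new_points P k))))
      \<le> ennreal (C * V x r powr (-\<nu>))"
      by (subst sum_ennreal) (auto simp: exp_decay_def intro: ennreal_leI)
  qed (use \<open>0 < C\<close> in \<open>auto intro: nonneg_summable_on_complete\<close>)
qed

end
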